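(* For every domain size $k$, every $\alpha\in(0,1]$, and every $\varepsilon_1,\varepsilon_2\in(0,1]$, there exists a public-coin protocol for closeness testing between two unknown distributions $\mathbf p,\mathbf q$ over $[k]$ with distance parameter $\alpha$, using $n_1=O\!\left(\frac{k}{\alpha^2\varepsilon_1^2}\right)$ users holding samples from $\mathbf p$ and $n_2=O\!\left(\frac{k}{\alpha^2\varepsilon_2^2}\right)$ users holding samples from $\mathbf q$, which is $(\varepsilon_1,0)$-locally differentially private for the users holding samples from $\mathbf p$ and $(\varepsilon_2,0)$-locally differentially private for the users holding samples from $\mathbf q$.
   Context: Closeness testing: given $\alpha\in(0,1]$ and independent samples from unknown distributions $\mathbf p,\mathbf q$ over $[k]=\{1,\dots,k\}$, output accept with probability at least $2/3$ if $\mathbf p=\mathbf q$, and reject with probability at least $2/3$ if $d_{TV}(\mathbf p,\mathbf q)=\frac12\|\mathbf p-\mathbf q\|_1>\alpha$. Heterogeneous local model: there are $n_1$ users, each holding one independent sample $x_i\sim\mathbf p$, and $n_2$ users, each holding one independent sample $x'_i\sim\mathbf q$. Each user of the first group applies a randomizer $R_i(x_i,U)$ and each user of the second group a randomizer $R'_i(x'_i,U)$, where $U$ is a public random string of length $r$ independent of the data and available to all parties; an analyzer receives all messages (knowing which group each came from) and $U$, and outputs accept or reject satisfying the closeness testing guarantee (probability over samples, $U$ and all randomizers). The protocol is private-coin if $r=0$ and public-coin otherwise. A randomizer $R$ is $(\varepsilon,\delta)$-locally differentially private if for every value of $U$, all inputs $x,x'$ and all measurable sets $S$, $\Pr[R(x,U)\in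 S]\le e^{\varepsilon}\Pr[R(x',U)\in S]+\delta$. The protocol is $(\varepsilon_1,0)$-LDP for the first group if every $R_i$ is, and $(\varepsilon_2,0)$-LDP for the second group if every $R'_i$ is. *)

theory Defs
  imports "HOL-Probability.Probability"
begin

text \<open>
  A distribution over \<open>[k]\<close> is a \<^typ>\<open>nat pmf\<close> whose support is contained in \<open>{1..k}\<close>.
\<close>
definition dist_on :: "nat \<Rightarrow> nat pmf \<Rightarrow> bool" where
  "dist_on k p \<longleftrightarrow> set_pmf p \<subseteq> {1..k}"

definition tv_dist :: "nat \<Rightarrow> nat pmf \<Rightarrow> nat pmf \<Rightarrow> real" where
  "tv_dist k p q = (1/2) * (\<Sum>x\<in>{1..k}. \<bar>pmf p x - pmf q x\<bar>)"

definition bit_strings :: "nat \<Rightarrow> bool list set" where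
  "bit_strings r = {u. length u = r}"

text \<open>
  Users of each group are numbered from 0. A randomizer maps the user's sample and the public
  string to the law of the message. The analyzer takes the two message families separately, so
  it knows the group of each message; \<open>True\<close> means accept. It has no randomness of its own.
\<close>
record 'm protocol =
  num1 :: nat
  num2 :: nat
  coins :: nat
  msg_space :: "'m measure"
  rand1 :: "nat \<Rightarrow> nat \<Rightarrow> bool list \<Rightarrow> 'm measure"
  rand2 :: "nat \<Rightarrow> nat \<Rightarrow> bool list \<Rightarrow> 'm measure"
  analyzer :: "(nat \<Rightarrow> 'm) \<Rightarrow> (nat \<Rightarrow> 'm) \<Rightarrow> bool list \<Rightarrow> bool"

definition valid_protocol :: "nat \<Rightarrow> 'm protocol \<Rightarrow> bool" where
  "valid_protocol k P \<longleftrightarrow>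
    (\<forall>i<num1 P. \<forall>x\<in>{1..k}. \<forall>u\<in>bit_strings (coins P).
        rand1 P i x u \<in> space (prob_algebra (msg_space P))) \<and>
    (\<forall>i<num2 P. \<forall>x\<in>{1..k}. \<forall>u\<in>bit_strings (coins P).
        rand2 P i x u \<in> space (prob_algebra (msg_space P))) \<and>
    (\<forall>u\<in>bit_strings (coins P).
        (\<lambda>(y, y'). analyzer P y y' u) \<in>
          PiM {..<num1 P} (\<lambda>_. msg_space P) \<Otimes>\<^sub>M PiM {..<num2 P} (\<lambda>_. msg_space P)
            \<rightarrow>\<^sub>M count_space UNIV)"

definition public_coin :: "'m protocol \<Rightarrow> bool" where
  "public_coin P \<longleftrightarrow> coins P > 0"

definition ldp_randomizer ::
  "nat \<Rightarrow> nat \<Rightarrow> 'm measure \<Rightarrow> real \<Rightarrow> real \<Rightarrow> (nat \<Rightarrow> bool list \<Rightarrow> 'm measure) \<Rightarrow> bool" where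
  "ldp_randomizer k r Y \<epsilon> \<delta> R \<longleftrightarrow>
    (\<forall>u\<in>bit_strings r. \<forall>x\<in>{1..k}. \<forall>x'\<in>{1..k}. \<forall>S\<in>sets Y.
        measure (R x u) S \<le> exp \<epsilon> * measure (R x' u) S + \<delta>)"

definition ldp_group1 :: "nat \<Rightarrow> real \<Rightarrow> real \<Rightarrow> 'm protocol \<Rightarrow> bool" where
  "ldp_group1 k \<epsilon> \<delta> P \<longleftrightarrow>
    (\<forall>i<num1 P. ldp_randomizer k (coins P) (msg_space P) \<epsilon> \<delta> (rand1 P i))"

definition ldp_group2 :: "nat \<Rightarrow> real \<Rightarrow> real \<Rightarrow> 'm protocol \<Rightarrow> bool" where
  "ldp_group2 k \<epsilon> \<delta> P \<longleftrightarrow>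
    (\<forall>i<num2 P. ldp_randomizer k (coins P) (msg_space P) \<epsilon> \<delta> (rand2 P i))"

text \<open>
  The public string is uniform, and it and all samples are independent. The default value \<open>0\<close>
  of \<^const>\<open>Pi_pmf\<close> is immaterial: it is taken only at indices that are not users.
\<close>
definition coins_and_samples ::
  "'m protocol \<Rightarrow> nat pmf \<Rightarrow> nat pmf \<Rightarrow> (bool list \<times> (nat \<Rightarrow> nat) \<times> (nat \<Rightarrow> nat)) pmf" where
  "coins_and_samples P p q =
    pair_pmf (pmf_of_set (bit_strings (coins P)))
      (pair_pmf (Pi_pmf {..<num1 P} 0 (\<lambda>_. p)) (Pi_pmf {..<num2 P} 0 (\<lambda>_. q)))"

definition messages ::
  "'m protocol \<Rightarrow> bool list \<Rightarrow> (nat \<Rightarrow> nat) \<Rightarrow> (nat \<Rightarrow> nat) \<Rightarrow> ((nat \<Rightarrow> 'm) \<times> (nat \<Rightarrow> 'm)) measure" where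
  "messages P u x x' =
    PiM {..<num1 P} (\<lambda>i. rand1 P i (x i) u) \<Otimes>\<^sub>M PiM {..<num2 P} (\<lambda>i. rand2 P i (x' i) u)"

text \<open>
  The probability of output \<open>b\<close> over public string, samples and randomizers: given the former
  two, the messages are independent with the laws prescribed by the randomizers. Since the
  public string and the samples are discrete, averaging over them needs no measurability.
\<close>
definition output_prob :: "'m protocol \<Rightarrow> nat pmf \<Rightarrow> nat pmf \<Rightarrow> bool \<Rightarrow> real" where
  "output_prob P p q b =
    measure_pmf.expectation (coins_and_samples P p q)
      (\<lambda>(u, x, x'). measure (messages P u x x')
         {(y, y') \<in> space (messages P u x x'). analyzer P y y' u = b})"

definition closeness_tester :: "nat \<Rightarrow> real \<Rightarrow> 'm protocol \<Rightarrow> bool" where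
  "closeness_tester k \<alpha> P \<longleftrightarrow>
    (\<forall>p q. dist_on k p \<longrightarrow> dist_on k q \<longrightarrow>
       (p = q \<longrightarrow> output_prob P p q True \<ge> 2/3) \<and>
       (tv_dist k p q > \<alpha> \<longrightarrow> output_prob P p q False \<ge> 2/3))"

end

theory Submission
  imports Defs
begin

text \<open>
  The public string provides eight independent sign vectors \<open>s\<close> in \<open>{-1, 1}\<^sup>k\<close>, and the users are
  divided into eight blocks. A user of a block holding \<open>x\<close> sends the sign \<open>s x\<close> by randomized
  response; rescaled block averages estimate the means \<open>\<langle>s, p\<rangle>\<close> and \<open>\<langle>s, q\<rangle>\<close>, and the analyzer accepts
  if in every block the two estimates are closer than \<open>\<tau> = \<alpha> / (2 sqrt k)\<close>.

  The estimates have variance of order \<open>1 / (\<epsilon>\<^sup>2 N)\<close> for blocks of \<open>N\<close> users, so Chebyshev's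
  inequality makes both errors small relative to \<open>\<tau>\<close> once \<open>N\<close> is a large multiple of
  \<open>k / (\<alpha>\<^sup>2 \<epsilon>\<^sup>2)\<close>. If \<open>p\<close> and \<open>q\<close> are far apart, \<open>D = \<langle>s, p - q\<rangle>\<close> has second moment
  \<open>V = \<parallel>p - q\<parallel>\<^sub>2\<^sup>2 \<ge> 4 \<alpha>\<^sup>2 / k\<close> and fourth moment at most \<open>3 V\<^sup>2\<close>, hence by the Paley-Zygmund
  argument \<open>D\<^sup>2 \<ge> V / 4\<close>, that is \<open>\<bar>D\<bar> \<ge> 2 \<tau>\<close>, with probability at least \<open>3 / 16\<close>. Eight blocks
  boost this to more than \<open>4 / 5\<close>.
\<close>

subsection \<open>Products of discrete distributions\<close>

lemma expectation_bind_pmf: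
  fixes f :: "'b \<Rightarrow> real"
  assumes "\<And>y. \<bar>f y\<bar> \<le> B"
  shows "measure_pmf.expectation (bind_pmf M N) f
    = measure_pmf.expectation M (\<lambda>x. measure_pmf.expectation (N x) f)"
  unfolding measure_pmf_bind
proof (rule integral_bind[where K = "count_space UNIV" and B' = 1 and B = B])
  show "finite_measure (measure_pmf M)" by unfold_locales
qed (use assms measurable_measure_pmf[of N] in \<open>auto simp: measure_pmf.emeasure_space_1\<close>)

lemma prob_bind_pmf:
  "measure_pmf.prob (bind_pmf M N) X = measure_pmf.expectation M (\<lambda>x. measure_pmf.prob (N x) X)"
  using expectation_bind_pmf[of "indicat_real X" 1 M N] by (simp add: indicator_def)

lemma expectation_pair_pmf:
  fixes f :: "'a \<times> 'b \<Rightarrow> real"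
  assumes "\<And>y. \<bar>f y\<bar> \<le> B"
  shows "measure_pmf.expectation (pair_pmf M N) f
    = measure_pmf.expectation M (\<lambda>x. measure_pmf.expectation N (\<lambda>y. f (x, y)))"
  unfolding pair_pmf_def by (simp add: expectation_bind_pmf[OF assms])

lemma emeasure_pair_pmf_Times:
  "emeasure (pair_pmf M N) (A \<times> B) = emeasure M A * emeasure N B"
proof -
  have "emeasure (pair_pmf M N) (A \<times> B)
      = (\<integral>\<^sup>+x. \<integral>\<^sup>+y. indicator A x * indicator B y \<partial>N \<partial>M)"
    by (simp flip: nn_integral_indicator add: nn_integral_pair_pmf' indicator_times)
  then show ?thesis
    by (simp add: nn_integral_cmult nn_integral_multc)
qed

lemma sets_PiM_measure_pmf:
  "sets (PiM I (\<lambda>i. measure_pmf (p i))) = sets (PiM I (\<lambda>_. count_space UNIV))"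
  by (intro sets_PiM_cong refl) simp

text \<open>\<open>Pi_pmf\<close> takes the value \<open>d\<close> outside \<open>I\<close>, while
  \<open>PiM\<close> lives on functions that are \<open>undefined\<close> there; restricting to
  \<open>I\<close> reconciles the two conventions. Both measures give a box the product of its
  marginal masses, and boxes determine a finite product measure.\<close>

lemma PiM_measure_pmf:
  assumes "finite I"
  shows "PiM I (\<lambda>i. measure_pmf (p i))
    = distr (measure_pmf (Pi_pmf I d p)) (PiM I (\<lambda>_. count_space UNIV)) (\<lambda>f. restrict f I)"
    (is "_ = ?D")
proof -
  interpret product_sigma_finite "\<lambda>i. measure_pmf (p i)" by unfold_locales
  have "?D = PiM I (\<lambda>i. measure_pmf (p i))"
  proof (rule PiM_eqI)
    show "sets ?D = sets (PiM I (\<lambda>i. measure_pmf (p i)))"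
      by (simp add: sets_PiM_measure_pmf)
    fix A assume "\<And>i. i \<in> I \<Longrightarrow> A i \<in> sets (measure_pmf (p i))"
    have "emeasure ?D (Pi\<^sub>E I A)
        = emeasure (Pi_pmf I d p) ((\<lambda>f. restrict f I) -` Pi\<^sub>E I A)"
      by (subst emeasure_distr) (auto intro!: sets_PiM_I_finite assms simp: space_PiM)
    also have "(\<lambda>f. restrict f I) -` Pi\<^sub>E I A = Pi I A" by (auto simp: Pi_iff PiE_iff)
    finally show "emeasure ?D (Pi\<^sub>E I A) = (\<Prod>i\<in>I. emeasure (measure_pmf (p i)) (A i))"
      using assms
      by (simp only: measure_pmf.emeasure_eq_measure measure_Pi_pmf_Pi prod_ennreal measure_nonneg)
  qed fact
  then show ?thesis ..
qed

text \<open>This bridges the measure-theoretic \<open>messages\<close> and the calculus of pmfs. The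
  two measures agree on measurable rectangles, hence on the whole product sigma-algebra, to which
  \<open>X\<close> must belong.\<close>

lemma measure_pair_PiM_pmf:
  assumes "finite I" "finite J"
    and "X \<in> sets (PiM I (\<lambda>_. count_space UNIV) \<Otimes>\<^sub>M PiM J (\<lambda>_. count_space UNIV))"
  shows "measure (PiM I (\<lambda>i. measure_pmf (p i)) \<Otimes>\<^sub>M PiM J (\<lambda>i. measure_pmf (q i))) X
    = measure_pmf.prob (pair_pmf (Pi_pmf I d p) (Pi_pmf J d' q))
        {(y, y'). (restrict y I, restrict y' J) \<in> X}"
proof -
  let ?P = "measure_pmf (Pi_pmf I d p)" and ?Q = "measure_pmf (Pi_pmf J d' q)"
  let ?A = "PiM I (\<lambda>i. measure_pmf (p i))" and ?B = "PiM J (\<lambda>i. measure_pmf (q i))"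
  let ?K = "PiM I (\<lambda>_. count_space UNIV) \<Otimes>\<^sub>M PiM J (\<lambda>_. count_space UNIV)"
  let ?D = "distr (pair_pmf (Pi_pmf I d p) (Pi_pmf J d' q)) ?K (\<lambda>(y, y'). (restrict y I, restrict y' J))"
  interpret A: prob_space ?A by (intro prob_space_PiM measure_pmf.prob_space_axioms)
  interpret B: prob_space ?B by (intro prob_space_PiM measure_pmf.prob_space_axioms)
  have meas: "(\<lambda>(y, y'). (restrict y I, restrict y' J))
      \<in> measure_pmf (pair_pmf (Pi_pmf I d p) (Pi_pmf J d' q)) \<rightarrow>\<^sub>M ?K"
    by (auto simp: space_pair_measure space_PiM measurable_def)
  have "?A \<Otimes>\<^sub>M ?B = ?D"
  proof (rule pair_measure_eqI)
    show "sets (?A \<Otimes>\<^sub>M ?B) = sets ?D"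
      by (simp add: sets_pair_measure_cong[OF sets_PiM_measure_pmf sets_PiM_measure_pmf])
    fix S T assume ST: "S \<in> sets ?A" "T \<in> sets ?B"
    have ST': "S \<in> sets (PiM I (\<lambda>_. count_space UNIV))" "T \<in> sets (PiM J (\<lambda>_. count_space UNIV))"
      using ST by (simp_all only: sets_PiM_measure_pmf)
    have "emeasure ?D (S \<times> T) = emeasure (pair_pmf (Pi_pmf I d p) (Pi_pmf J d' q))
        (((\<lambda>f. restrict f I) -` S) \<times> ((\<lambda>f. restrict f J) -` T))"
      using ST' meas by (subst emeasure_distr) (auto intro!: arg_cong[where f = "emeasure _"])
    also have "\<dots> = emeasure ?P ((\<lambda>f. restrict f I) -` S) * emeasure ?Q ((\<lambda>f. restrict f J) -` T)"
      by (rule emeasure_pair_pmf_Times)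
    also have "\<dots> = emeasure ?A S * emeasure ?B T"
      using ST' assms(1,2)
      by (simp add: PiM_measure_pmf[where d = d] PiM_measure_pmf[where d = d'] emeasure_distr
          measurable_def space_PiM)
    finally show "emeasure ?A S * emeasure ?B T = emeasure ?D (S \<times> T)" ..
  qed unfold_locales
  then have "measure (?A \<Otimes>\<^sub>M ?B) X = measure ?D X" by simp
  also have "\<dots> = measure_pmf.prob (pair_pmf (Pi_pmf I d p) (Pi_pmf J d' q))
        {(y, y'). (restrict y I, restrict y' J) \<in> X}"
    using assms(3) meas by (subst measure_distr) (auto intro!: arg_cong[where f = "measure _"])
  finally show ?thesis .
qed

section \<open>Concentration of sums of independent bounded terms\<close>

lemma second_moment_sum_Pi_pmf:
  fixes g :: "'i \<Rightarrow> 'a \<Rightarrow> real"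
  assumes "finite I"
    and bounded: "\<And>i y. i \<in> I \<Longrightarrow> y \<in> set_pmf (p i) \<Longrightarrow> \<bar>g i y\<bar> \<le> B"
    and centred: "\<And>i. i \<in> I \<Longrightarrow> measure_pmf.expectation (p i) (g i) = 0"
  shows "integrable (Pi_pmf I d p) (\<lambda>y. (\<Sum>i\<in>I. g i (y i))\<^sup>2)"
    and "measure_pmf.expectation (Pi_pmf I d p) (\<lambda>y. (\<Sum>i\<in>I. g i (y i))\<^sup>2)
      \<le> real (card I) * B\<^sup>2"
proof -
  let ?M = "measure_pmf (Pi_pmf I d p)"
  have bound: "\<bar>g i (y i)\<bar> \<le> B" if "i \<in> I" "y \<in> set_pmf (Pi_pmf I d p)" for i y
    using that bounded assms(1) by (auto simp: set_Pi_pmf PiE_dflt_def)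
  have prod_bound: "\<bar>g i (y i) * g j (y j)\<bar> \<le> B * B"
    if "i \<in> I" "j \<in> I" "y \<in> set_pmf (Pi_pmf I d p)" for i j y
    unfolding abs_mult using bound that by (intro mult_mono) (auto intro: order_trans[OF abs_ge_zero])
  have int: "integrable ?M (\<lambda>y. g i (y i) * g j (y j))" if "i \<in> I" "j \<in> I" for i j
    using that prod_bound
    by (intro measure_pmf.integrable_const_bound[where B = "B * B"]) (auto simp: AE_measure_pmf_iff)
  have int1: "integrable ?M (\<lambda>y. g i (y i))" if "i \<in> I" for i
    using that bound
    by (intro measure_pmf.integrable_const_bound[where B = B]) (auto simp: AE_measure_pmf_iff)
  have square: "(\<Sum>i\<in>I. g i (y i))\<^sup>2 = (\<Sum>i\<in>I. \<Sum>j\<in>I. g i (y i) * g j (y j))" for y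
    by (simp add: power2_eq_square sum_product)
  show "integrable ?M (\<lambda>y. (\<Sum>i\<in>I. g i (y i))\<^sup>2)"
    unfolding square using int by (intro Bochner_Integration.integrable_sum)
  have mean: "measure_pmf.expectation (Pi_pmf I d p) (\<lambda>y. g i (y i)) = 0" if "i \<in> I" for i
  proof -
    have "measure_pmf.expectation (Pi_pmf I d p) (\<lambda>y. g i (y i))
        = measure_pmf.expectation (map_pmf (\<lambda>y. y i) (Pi_pmf I d p)) (g i)" by simp
    then show ?thesis
      using that centred assms(1) by (simp only: Pi_pmf_component if_True)
  qed
  have indep: "prob_space.indep_vars (measure_pmf (Pi_pmf I d p)) (\<lambda>_. borel) (\<lambda>i y. g i (y i)) I"
    by (rule prob_space.indep_vars_compose2[OF measure_pmf.prob_space_axioms indep_vars_Pi_pmf[OF assms(1)]]) auto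
  \<comment> \<open>Independence of two distinct coordinates factors the expectation of their
    product, and both factors are centred. Only the diagonal of the squared sum survives.\<close>
  have cross: "measure_pmf.expectation (Pi_pmf I d p) (\<lambda>y. g i (y i) * g j (y j)) = 0"
    if "i \<in> I" "j \<in> I" "i \<noteq> j" for i j
  proof -
    have "measure_pmf.expectation (Pi_pmf I d p) (\<lambda>y. \<Prod>l\<in>{i, j}. g l (y l))
        = (\<Prod>l\<in>{i, j}. measure_pmf.expectation (Pi_pmf I d p) (\<lambda>y. g l (y l)))"
      using that int1
      by (intro prob_space.indep_vars_lebesgue_integral[OF measure_pmf.prob_space_axioms]
          prob_space.indep_vars_subset[OF measure_pmf.prob_space_axioms indep]) auto
    with that mean show ?thesis by simp
  qed
  have "measure_pmf.expectation (Pi_pmf I d p) (\<lambda>y. (\<Sum>i\<in>I. g i (y i))\<^sup>2)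
      = (\<Sum>i\<in>I. \<Sum>j\<in>I. measure_pmf.expectation (Pi_pmf I d p) (\<lambda>y. g i (y i) * g j (y j)))"
    unfolding square using int by (simp add: Bochner_Integration.integral_sum)
  also have "\<dots> = (\<Sum>i\<in>I. measure_pmf.expectation (Pi_pmf I d p) (\<lambda>y. g i (y i) * g i (y i)))"
  proof (rule sum.cong[OF refl])
    fix i assume "i \<in> I"
    with assms(1) show "(\<Sum>j\<in>I. measure_pmf.expectation (Pi_pmf I d p) (\<lambda>y. g i (y i) * g j (y j)))
        = measure_pmf.expectation (Pi_pmf I d p) (\<lambda>y. g i (y i) * g i (y i))"
      by (subst sum.remove[of I i]) (auto intro!: sum.neutral cross)
  qed
  also have "\<dots> \<le> (\<Sum>i\<in>I. B\<^sup>2)"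
  proof (rule sum_mono)
    fix i assume "i \<in> I"
    with int[of i i] prod_bound[of i i]
    show "measure_pmf.expectation (Pi_pmf I d p) (\<lambda>y. g i (y i) * g i (y i)) \<le> B\<^sup>2"
      by (intro measure_pmf.integral_le_const) (auto simp: AE_measure_pmf_iff power2_eq_square)
  qed
  finally show "measure_pmf.expectation (Pi_pmf I d p) (\<lambda>y. (\<Sum>i\<in>I. g i (y i))\<^sup>2)
      \<le> real (card I) * B\<^sup>2" by simp
qed

text \<open>Chebyshev's inequality, as Markov's inequality for the square of the centred sum.
  Centring at most doubles the bound on a term, hence \<open>2 * B\<close>. The coordinates may have
  different laws.\<close>

lemma prob_sum_deviation_Pi_pmf:
  fixes f :: "'i \<Rightarrow> 'a \<Rightarrow> real"
  assumes "finite I" "t > 0"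
    and bounded: "\<And>i y. i \<in> I \<Longrightarrow> y \<in> set_pmf (p i) \<Longrightarrow> \<bar>f i y\<bar> \<le> B"
  shows "measure_pmf.prob (Pi_pmf I d p)
      {y. t \<le> \<bar>(\<Sum>i\<in>I. f i (y i)) - (\<Sum>i\<in>I. measure_pmf.expectation (p i) (f i))\<bar>}
    \<le> real (card I) * (2 * B)\<^sup>2 / t\<^sup>2"
proof -
  define g where "g i y = f i y - measure_pmf.expectation (p i) (f i)" for i y
  define G where "G y = (\<Sum>i\<in>I. g i (y i))" for y
  have int: "integrable (p i) (f i)" if "i \<in> I" for i
    using that bounded
    by (intro measure_pmf.integrable_const_bound[where B = B]) (auto simp: AE_measure_pmf_iff)
  have mean_bound: "\<bar>measure_pmf.expectation (p i) (f i)\<bar> \<le> B" if "i \<in> I" for i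
  proof -
    have "measure_pmf.expectation (p i) (f i) \<le> B"
      using that bounded[OF that] int
      by (intro measure_pmf.integral_le_const) (force simp: AE_measure_pmf_iff abs_le_iff)+
    moreover have "- B \<le> measure_pmf.expectation (p i) (f i)"
      using that bounded[OF that] int
      by (intro measure_pmf.integral_ge_const) (force simp: AE_measure_pmf_iff abs_le_iff)+
    ultimately show ?thesis by simp
  qed
  have bounded_g: "\<bar>g i y\<bar> \<le> 2 * B" if "i \<in> I" "y \<in> set_pmf (p i)" for i y
    using bounded[OF that] mean_bound[OF that(1)] by (simp add: g_def)
  have centred_g: "measure_pmf.expectation (p i) (g i) = 0" if "i \<in> I" for i
    unfolding g_def using int[OF that] by simp
  have moment: "integrable (Pi_pmf I d p) (\<lambda>y. (G y)\<^sup>2)"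
    "measure_pmf.expectation (Pi_pmf I d p) (\<lambda>y. (G y)\<^sup>2) \<le> real (card I) * (2 * B)\<^sup>2"
    unfolding G_def by (rule second_moment_sum_Pi_pmf; fact)+
  have "measure_pmf.prob (Pi_pmf I d p) {y. t\<^sup>2 \<le> (G y)\<^sup>2}
      \<le> measure_pmf.expectation (Pi_pmf I d p) (\<lambda>y. (G y)\<^sup>2) / t\<^sup>2"
    using integral_Markov_inequality_measure[OF moment(1), of "{}" "t\<^sup>2"] \<open>t > 0\<close> by simp
  also have "\<dots> \<le> real (card I) * (2 * B)\<^sup>2 / t\<^sup>2"
    using moment(2) by (intro divide_right_mono) auto
  also have "{y. t\<^sup>2 \<le> (G y)\<^sup>2}
      = {y. t \<le> \<bar>(\<Sum>i\<in>I. f i (y i)) - (\<Sum>i\<in>I. measure_pmf.expectation (p i) (f i))\<bar>}"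
    using \<open>t > 0\<close> abs_le_square_iff[of t] by (simp add: G_def g_def sum_subtractf)
  finally show ?thesis .
qed

subsection \<open>Random sign vectors\<close>

definition sign :: "bool \<Rightarrow> real" where
  "sign b = (if b then 1 else -1)"

text \<open>Coefficients are numbered from 0 to match list positions; for a distribution on
  \<open>{1..k}\<close> they are therefore taken as \<open>pmf p (Suc x)\<close>.\<close>

definition signed_sum :: "(nat \<Rightarrow> real) \<Rightarrow> nat \<Rightarrow> bool list \<Rightarrow> real" where
  "signed_sum a k u = (\<Sum>x<k. a x * sign (u ! x))"

lemma finite_bit_strings: "finite (bit_strings n)"
  using finite_lists_length_eq[of "UNIV :: bool set" n] by (simp add: bit_strings_def)

lemma card_bit_strings: "card (bit_strings n) = 2 ^ n"
  using card_lists_length_eq[of "UNIV :: bool set" n] by (simp add: bit_strings_def)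

lemma bit_strings_nonempty: "bit_strings n \<noteq> {}"
  using card_bit_strings[of n] by auto

lemma bit_strings_Suc: "bit_strings (Suc n) = Cons True ` bit_strings n \<union> Cons False ` bit_strings n"
  by (auto simp: bit_strings_def length_Suc_conv image_iff)

lemma sum_bit_strings_Suc:
  "(\<Sum>u\<in>bit_strings (Suc n). f u) = (\<Sum>u\<in>bit_strings n. f (True # u) + f (False # u))"
  unfolding bit_strings_Suc
  by (subst sum.union_disjoint) (auto simp: finite_bit_strings sum.reindex sum.distrib)

lemma signed_sum_Cons:
  "signed_sum a (Suc n) (b # u) = a 0 * sign b + signed_sum (\<lambda>x. a (Suc x)) n u"
  by (simp add: signed_sum_def lessThan_Suc_eq_insert_0 sum.reindex)

text \<open>Signs are orthogonal: pairing the two choices of the first sign cancels the cross term,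
  (S + c)^2 + (S - c)^2 = 2 S^2 + 2 c^2.\<close>

lemma signed_sum_second_moment:
  "(\<Sum>u\<in>bit_strings n. (signed_sum a n u)\<^sup>2) = 2 ^ n * (\<Sum>x<n. (a x)\<^sup>2)"
proof (induction n arbitrary: a)
  case 0
  then show ?case by (simp add: signed_sum_def)
next
  case (Suc n)
  let ?S = "signed_sum (\<lambda>x. a (Suc x)) n"
  have "(\<Sum>u\<in>bit_strings (Suc n). (signed_sum a (Suc n) u)\<^sup>2)
      = (\<Sum>u\<in>bit_strings n. 2 * (?S u)\<^sup>2 + 2 * (a 0)\<^sup>2)"
    unfolding sum_bit_strings_Suc
    by (intro sum.cong) (auto simp: signed_sum_Cons sign_def power2_eq_square algebra_simps)
  then show ?case
    by (simp add: sum.distrib Suc.IH card_bit_strings lessThan_Suc_eq_insert_0 sum.reindex algebra_simps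
        flip: sum_distrib_left)
qed

text \<open>Odd powers cancel between the two choices of the first sign: (S + c)^4 + (S - c)^4 = 2
  S^4 + 12 c^2 S^2 + 2 c^4.\<close>

lemma signed_sum_fourth_moment:
  "(\<Sum>u\<in>bit_strings n. (signed_sum a n u) ^ 4) \<le> 2 ^ n * (3 * (\<Sum>x<n. (a x)\<^sup>2)\<^sup>2)"
proof (induction n arbitrary: a)
  case 0
  then show ?case by (simp add: signed_sum_def)
next
  case (Suc n)
  let ?S = "signed_sum (\<lambda>x. a (Suc x)) n" and ?V = "\<Sum>x<n. (a (Suc x))\<^sup>2"
  have "(\<Sum>u\<in>bit_strings (Suc n). (signed_sum a (Suc n) u) ^ 4)
      = (\<Sum>u\<in>bit_strings n. 2 * ?S u ^ 4 + 12 * (a 0)\<^sup>2 * (?S u)\<^sup>2 + 2 * a 0 ^ 4)"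
    unfolding sum_bit_strings_Suc
    by (intro sum.cong) (auto simp: signed_sum_Cons sign_def power4_eq_xxxx power2_eq_square algebra_simps)
  also have "\<dots> = 2 * (\<Sum>u\<in>bit_strings n. ?S u ^ 4) + 12 * (a 0)\<^sup>2 * (2 ^ n * ?V)
      + 2 * 2 ^ n * a 0 ^ 4"
    by (simp add: sum.distrib signed_sum_second_moment card_bit_strings flip: sum_distrib_left)
  \<comment> \<open>Besides the induction hypothesis, c^4 is enlarged to 3 c^4 so that the terms
    complete to 3 (c^2 + V)^2.\<close>
  also have "\<dots> \<le> 2 * (2 ^ n * (3 * ?V\<^sup>2)) + 12 * (a 0)\<^sup>2 * (2 ^ n * ?V) + 2 * 2 ^ n * (3 * a 0 ^ 4)"
    using Suc.IH by (intro add_mono mult_left_mono) auto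
  also have "\<dots> = 2 ^ Suc n * (3 * ((a 0)\<^sup>2 + ?V)\<^sup>2)"
    by (simp add: power4_eq_xxxx power2_eq_square algebra_simps)
  finally show ?case
    by (simp add: lessThan_Suc_eq_insert_0 sum.reindex)
qed

text \<open>Anti-concentration in the manner of Paley and Zygmund: a fourth moment comparable to the
  squared second moment prevents the signed sum from being small for nearly all sign
  vectors.\<close>

lemma card_small_signed_sum:
  assumes V: "V = (\<Sum>x<k. (a x)\<^sup>2)" and "V > 0"
  shows "real (card {u \<in> bit_strings k. (signed_sum a k u)\<^sup>2 < V / 4}) \<le> 13 / 16 * 2 ^ k"
proof -
  let ?S = "signed_sum a k" and ?T = "{u \<in> bit_strings k. (signed_sum a k u)\<^sup>2 < V / 4}"
  \<comment> \<open>with \<open>w = D\<^sup>2 / V\<close>: the quadratic \<open>1 - (w / 2 - 1 / 8 - w\<^sup>2 / 16)\<close> dominates the indicator of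
    \<open>w < 1 / 4\<close>, and its mean only involves the second and fourth moments\<close>
  have pointwise: "of_bool (u \<in> ?T) \<le> 9 / 8 - (?S u)\<^sup>2 / (2 * V) + ?S u ^ 4 / (16 * V\<^sup>2)" for u
  proof -
    define w where "w = (?S u)\<^sup>2 / V"
    have "?S u ^ 4 = ((?S u)\<^sup>2)\<^sup>2" by (simp flip: power_mult)
    then have eq: "9 / 8 - (?S u)\<^sup>2 / (2 * V) + ?S u ^ 4 / (16 * V\<^sup>2) = 9 / 8 - w / 2 + w\<^sup>2 / 16"
      using \<open>V > 0\<close> by (simp add: w_def power_divide)
    \<comment> \<open>Completing the square gives positivity for every w; if w < 1/4, already 9/8 -
      w/2 exceeds 1.\<close>
    have "9 / 8 - w / 2 + w\<^sup>2 / 16 = (w - 4)\<^sup>2 / 16 + 1 / 8"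
      by (simp add: power2_eq_square field_simps)
    then have "0 \<le> 9 / 8 - w / 2 + w\<^sup>2 / 16" by simp
    moreover have small: "w < 1 / 4" if "u \<in> ?T" using that \<open>V > 0\<close> by (simp add: w_def field_simps)
    then have "1 \<le> 9 / 8 - w / 2 + w\<^sup>2 / 16" if "u \<in> ?T"
      using small[OF that] zero_le_power2[of w] by linarith
    ultimately show ?thesis unfolding eq by auto
  qed
  have "real (card ?T) = (\<Sum>u\<in>bit_strings k. of_bool (u \<in> ?T))"
    by (simp add: finite_bit_strings Int_def)
  also have "\<dots> \<le> (\<Sum>u\<in>bit_strings k. 9 / 8 - (?S u)\<^sup>2 / (2 * V) + ?S u ^ 4 / (16 * V\<^sup>2))"
    by (intro sum_mono pointwise)
  also have "\<dots> = 9 / 8 * 2 ^ k - (2 ^ k * V) / (2 * V) + (\<Sum>u\<in>bit_strings k. ?S u ^ 4) / (16 * V\<^sup>2)"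
    by (simp add: sum.distrib sum_subtractf card_bit_strings signed_sum_second_moment V
        flip: sum_divide_distrib)
  also have "\<dots> \<le> 9 / 8 * 2 ^ k - (2 ^ k * V) / (2 * V) + (2 ^ k * (3 * V\<^sup>2)) / (16 * V\<^sup>2)"
    using signed_sum_fourth_moment[of a k] by (intro add_left_mono divide_right_mono) (auto simp: V)
  \<comment> \<open>The moments contribute 9/8 - 1/2 + 3/16 = 13/16.\<close>
  also have "\<dots> = 13 / 16 * 2 ^ k" using \<open>V > 0\<close> by (simp add: field_simps)
  finally show ?thesis .
qed

section \<open>Independent sign vectors from one public string\<close>

definition block :: "nat \<Rightarrow> nat \<Rightarrow> 'a list \<Rightarrow> 'a list" where
  "block k j u = take k (drop (j * k) u)"

text \<open>Independence of the blocks in counting form. A string of \<open>Suc m\<close> blocks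
  corresponds to its first block paired with the rest, and block \<open>Suc j\<close> of the whole
  is block \<open>j\<close> of the rest.\<close>

lemma card_all_blocks:
  "card {u \<in> bit_strings (m * k). \<forall>j<m. block k j u \<in> T} = card (T \<inter> bit_strings k) ^ m"
proof (induction m)
  case 0
  have "{u. length u = 0} = {[]::bool list}" by auto
  then show ?case by (simp add: bit_strings_def)
next
  case (Suc m)
  let ?A = "\<lambda>m. {u \<in> bit_strings (m * k). \<forall>j<m. block k j u \<in> T}"
  have "bij_betw (\<lambda>(v, u). v @ u) ((T \<inter> bit_strings k) \<times> ?A m) (?A (Suc m))"
  proof (rule bij_betwI[where g = "\<lambda>u. (take k u, drop k u)"])
    have block_append: "block k j (v @ u) = (if j = 0 then v else block k (j - 1) u)"
      if "length v = k" for j and v u :: "bool list"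
      using that by (cases j) (simp_all add: block_def)
    show "(\<lambda>(v, u). v @ u) \<in> (T \<inter> bit_strings k) \<times> ?A m \<rightarrow> ?A (Suc m)"
      using block_append by (auto simp: bit_strings_def less_Suc_eq_0_disj)
    show "(\<lambda>u. (take k u, drop k u)) \<in> ?A (Suc m) \<rightarrow> (T \<inter> bit_strings k) \<times> ?A m"
    proof
      fix u assume u: "u \<in> ?A (Suc m)"
      have "block k 0 u = take k u" by (simp add: block_def)
      moreover have "block k (Suc j) u = block k j (drop k u)" for j
        by (simp add: block_def add.commute)
      ultimately show "(take k u, drop k u) \<in> (T \<inter> bit_strings k) \<times> ?A m"
        using u by (auto simp: bit_strings_def less_Suc_eq_0_disj)
    qed
  qed (auto simp: bit_strings_def)
  then have "card (?A (Suc m)) = card ((T \<inter> bit_strings k) \<times> ?A m)"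
    by (simp add: bij_betw_same_card)
  then show ?case by (simp add: card_cartesian_product Suc.IH)
qed

lemma prob_all_blocks_small:
  assumes "V = (\<Sum>x<k. (a x)\<^sup>2)" and "V > 0"
  shows "measure_pmf.prob (pmf_of_set (bit_strings (m * k)))
      {u. \<forall>j<m. (signed_sum a k (block k j u))\<^sup>2 < V / 4} \<le> (13 / 16) ^ m"
proof -
  let ?T = "{u. (signed_sum a k u)\<^sup>2 < V / 4}"
  have "measure_pmf.prob (pmf_of_set (bit_strings (m * k)))
      {u. \<forall>j<m. (signed_sum a k (block k j u))\<^sup>2 < V / 4}
    = real (card {u \<in> bit_strings (m * k). \<forall>j<m. block k j u \<in> ?T}) / 2 ^ (m * k)"
    by (subst measure_pmf_of_set)
      (auto simp: finite_bit_strings bit_strings_nonempty card_bit_strings Int_def)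
  also have "\<dots> = (real (card (?T \<inter> bit_strings k)) / 2 ^ k) ^ m"
    unfolding card_all_blocks by (simp add: power_divide mult.commute[of m k] power_mult)

  also have "\<dots> \<le> (13 / 16) ^ m"
    using card_small_signed_sum[OF assms]
    by (intro power_mono) (auto simp: Int_def conj_commute field_simps)
  finally show ?thesis .
qed

subsection \<open>Protocols with discrete messages\<close>

text \<open>The draw from \<open>B\<close> does not depend on the draw from \<open>f x\<close>, so
  the two commute and the two halves separate.\<close>

lemma bind_pair_pmf_independent:
  "bind_pmf (pair_pmf A B) (\<lambda>(x, y). pair_pmf (f x) (g y)) = pair_pmf (bind_pmf A f) (bind_pmf B g)"
proof -
  have "bind_pmf (pair_pmf A B) (\<lambda>(x, y). pair_pmf (f x) (g y))
      = bind_pmf A (\<lambda>x. bind_pmf B (\<lambda>y. bind_pmf (f x) (\<lambda>a. bind_pmf (g y) (\<lambda>b. return_pmf (a, b)))))"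
    by (simp add: pair_pmf_def bind_assoc_pmf bind_return_pmf)
  also have "\<dots> = bind_pmf A (\<lambda>x. bind_pmf (f x) (\<lambda>a. bind_pmf B (\<lambda>y. bind_pmf (g y) (\<lambda>b. return_pmf (a, b)))))"
    by (subst bind_commute_pmf) (rule refl)
  finally show ?thesis
    by (simp add: pair_pmf_def bind_assoc_pmf)
qed

text \<open>For discrete messages, averaging over the samples replaces each randomizer by the mixture
  of its output laws, so that the messages become independent.\<close>
lemma output_prob_discrete:
  fixes P :: "'m protocol"
  assumes analyzer: "\<And>u. u \<in> bit_strings (coins P) \<Longrightarrow> (\<lambda>(y, y'). analyzer P y y' u)
      \<in> PiM {..<num1 P} (\<lambda>_. count_space UNIV) \<Otimes>\<^sub>M PiM {..<num2 P} (\<lambda>_. count_space UNIV)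
        \<rightarrow>\<^sub>M count_space UNIV"
    and rand: "rand1 P = (\<lambda>i x u. measure_pmf (R1 i x u))" "rand2 P = (\<lambda>i x u. measure_pmf (R2 i x u))"
  shows "output_prob P p q b = measure_pmf.expectation (pmf_of_set (bit_strings (coins P)))
    (\<lambda>u. measure_pmf.prob
      (pair_pmf (Pi_pmf {..<num1 P} d (\<lambda>i. bind_pmf p (\<lambda>x. R1 i x u)))
                (Pi_pmf {..<num2 P} d (\<lambda>i. bind_pmf q (\<lambda>x. R2 i x u))))
      {(y, y'). analyzer P (restrict y {..<num1 P}) (restrict y' {..<num2 P}) u = b})"
proof -
  let ?I = "{..<num1 P}" and ?J = "{..<num2 P}"
  let ?K = "PiM ?I (\<lambda>_. count_space UNIV) \<Otimes>\<^sub>M PiM ?J (\<lambda>_. count_space UNIV)"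
  define E where "E u = {(y, y'). analyzer P (restrict y ?I) (restrict y' ?J) u = b}" for u
  define L where "L u x x' = pair_pmf (Pi_pmf ?I d (\<lambda>i. R1 i (x i) u)) (Pi_pmf ?J d (\<lambda>i. R2 i (x' i) u))"
    for u x x'
  have "measure (messages P u x x') {(y, y') \<in> space (messages P u x x'). analyzer P y y' u = b}
      = measure_pmf.prob (L u x x') (E u)" if u: "u \<in> bit_strings (coins P)" for u x x'
  proof -
    define X where "X = {(y, y') \<in> space ?K. analyzer P y y' u = b}"
    have space: "space (messages P u x x') = space ?K"
      by (simp add: messages_def rand space_pair_measure space_PiM)
    have "X = (\<lambda>(y, y'). analyzer P y y' u) -` {b} \<inter> space ?K"
      by (auto simp: X_def)
    then have "X \<in> sets ?K"
      using measurable_sets[OF analyzer[OF u], of "{b}"] by simp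
    then have "measure (messages P u x x') X
        = measure_pmf.prob (L u x x') {(y, y'). (restrict y ?I, restrict y' ?J) \<in> X}"
      unfolding messages_def rand L_def by (intro measure_pair_PiM_pmf) auto
    also have "{(y, y'). (restrict y ?I, restrict y' ?J) \<in> X} = E u"
      by (auto simp: X_def E_def space_pair_measure space_PiM)
    finally show ?thesis unfolding space X_def .
  qed
  \<comment> \<open>Measurability of the analyzer is assumed only for strings of the right length,
    so the integrands are identified almost everywhere rather than pointwise.\<close>
  then have "output_prob P p q b = measure_pmf.expectation (coins_and_samples P p q)
      (\<lambda>(u, x, x'). measure_pmf.prob (L u x x') (E u))"
    unfolding output_prob_def coins_and_samples_def
    by (intro integral_cong_AE)
      (auto simp: AE_measure_pmf_iff set_pmf_of_set finite_bit_strings bit_strings_nonempty)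
  also have "\<dots> = measure_pmf.expectation (pmf_of_set (bit_strings (coins P)))
      (\<lambda>u. measure_pmf.expectation (pair_pmf (Pi_pmf ?I 0 (\<lambda>_. p)) (Pi_pmf ?J 0 (\<lambda>_. q)))
        (\<lambda>(x, x'). measure_pmf.prob (L u x x') (E u)))"
    unfolding coins_and_samples_def by (subst expectation_pair_pmf[where B = 1]) auto
  also have "(\<lambda>u. measure_pmf.expectation (pair_pmf (Pi_pmf ?I 0 (\<lambda>_. p)) (Pi_pmf ?J 0 (\<lambda>_. q)))
        (\<lambda>(x, x'). measure_pmf.prob (L u x x') (E u)))
    = (\<lambda>u. measure_pmf.prob (bind_pmf (pair_pmf (Pi_pmf ?I 0 (\<lambda>_. p)) (Pi_pmf ?J 0 (\<lambda>_. q)))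
        (\<lambda>(x, x'). L u x x')) (E u))"
    unfolding prob_bind_pmf by (simp add: case_prod_unfold)
  \<comment> \<open>Averaging a product law over independent samples acts coordinatewise. The
    default 0 belongs to the samples in \<open>coins_and_samples\<close>; the default
    \<open>d\<close> of the messages is arbitrary.\<close>
  also have "\<dots> = (\<lambda>u. measure_pmf.prob
      (pair_pmf (Pi_pmf ?I d (\<lambda>i. bind_pmf p (\<lambda>x. R1 i x u)))
                (Pi_pmf ?J d (\<lambda>i. bind_pmf q (\<lambda>x. R2 i x u)))) (E u))"
    unfolding L_def bind_pair_pmf_independent by (simp add: Pi_pmf_bind[where d' = 0])
  finally show ?thesis unfolding E_def .
qed

subsection \<open>Randomized response\<close>

text \<open>The bias \<epsilon>/8 is linear in \<epsilon>, so the signal has order \<epsilon>, yet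
  small enough for the privacy ratio to follow from 1 + \<epsilon> \<le> exp \<epsilon>. Messages
  are real signs so that they can be summed directly.\<close>

definition randomized_response :: "real \<Rightarrow> bool \<Rightarrow> real pmf" where
  "randomized_response \<epsilon> b = map_pmf sign (bernoulli_pmf (1 / 2 + \<epsilon> * sign b / 8))"

text \<open>Comparing point masses suffices, as events are sums of them: the largest possible mass
  is 1/2 + \<epsilon>/8 and the smallest is 1/2 - \<epsilon>/8.\<close>

lemma randomized_response_private:
  assumes "\<epsilon> \<in> {0<..1}"
  shows "measure_pmf.prob (randomized_response \<epsilon> b) S
    \<le> exp \<epsilon> * measure_pmf.prob (randomized_response \<epsilon> b') S"
proof -
  let ?B = "\<lambda>b. bernoulli_pmf (1 / 2 + \<epsilon> * sign b / 8)"
  have "\<epsilon> * \<epsilon> \<le> \<epsilon>" using assms by (simp add: mult_left_le)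
  moreover have "(1 + \<epsilon>) * (1 / 2 - \<epsilon> / 8) = 1 / 2 + 3 * \<epsilon> / 8 - \<epsilon> * \<epsilon> / 8"
    by (simp add: field_simps)
  ultimately have "1 / 2 + \<epsilon> / 8 \<le> (1 + \<epsilon>) * (1 / 2 - \<epsilon> / 8)" using assms by simp
  also have "\<dots> \<le> exp \<epsilon> * (1 / 2 - \<epsilon> / 8)"
    using assms by (intro mult_right_mono exp_ge_add_one_self) auto
  finally have ratio: "1 / 2 + \<epsilon> / 8 \<le> exp \<epsilon> * (1 / 2 - \<epsilon> / 8)" .
  have "pmf (?B b) c \<le> 1 / 2 + \<epsilon> / 8" for c
    using assms by (cases c) (auto simp: sign_def)
  moreover have "1 / 2 - \<epsilon> / 8 \<le> pmf (?B b') c" for c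
    using assms by (cases c) (auto simp: sign_def)
  ultimately have "pmf (?B b) c \<le> exp \<epsilon> * pmf (?B b') c" for c
    using ratio by (meson exp_ge_zero mult_left_mono order_trans)
  then show ?thesis
    by (simp add: randomized_response_def measure_measure_pmf_finite sum_distrib_left sum_mono)
qed

lemma set_randomized_response: "set_pmf (randomized_response \<epsilon> b) \<subseteq> {-1, 1}"
  by (auto simp: randomized_response_def sign_def)

lemma expectation_randomized_response:
  assumes "\<epsilon> \<in> {0<..1}"
  shows "measure_pmf.expectation (randomized_response \<epsilon> b) (\<lambda>y. y) = \<epsilon> * sign b / 4"
  using assms by (auto simp: randomized_response_def sign_def)

text \<open>The law of one message after averaging over the sample; \<open>x - 1\<close> converts an
  element of \<open>{1..k}\<close> to a list position.\<close>

definition message_law :: "real \<Rightarrow> bool list \<Rightarrow> nat pmf \<Rightarrow> real pmf" where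
  "message_law \<epsilon> v p = bind_pmf p (\<lambda>x. randomized_response \<epsilon> (v ! (x - 1)))"

lemma expectation_message_law:
  assumes "\<epsilon> \<in> {0<..1}" "dist_on k p"
  shows "measure_pmf.expectation (message_law \<epsilon> v p) (\<lambda>y. y)
    = \<epsilon> / 4 * signed_sum (\<lambda>x. pmf p (Suc x)) k v"
proof -
  have "finite (set_pmf (randomized_response \<epsilon> b))" for b
    by (rule finite_subset[OF set_randomized_response]) simp
  then have "measure_pmf.expectation (message_law \<epsilon> v p) (\<lambda>y. y)
      = (\<Sum>x\<in>{1..k}. pmf p x * (\<epsilon> * sign (v ! (x - 1)) / 4))"
    unfolding message_law_def using assms
    by (subst pmf_expectation_bind[of "{1..k}"]) (auto simp: dist_on_def expectation_randomized_response)
  also have "{1..k} = Suc ` {..<k}" by (simp add: image_Suc_lessThan)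
  finally show ?thesis
    by (simp add: sum.reindex signed_sum_def sum_distrib_left mult_ac)
qed

section \<open>Estimating signed sums from blocks of users\<close>

definition estimate :: "real \<Rightarrow> nat \<Rightarrow> nat \<Rightarrow> (nat \<Rightarrow> real) \<Rightarrow> real" where
  "estimate \<epsilon> N j y = (\<Sum>i\<in>{j * N..<Suc j * N}. 4 / (\<epsilon> * real N) * y i)"

lemma estimate_block_subset: "j < m \<Longrightarrow> {j * N..<Suc j * N} \<subseteq> {..<m * N}" for N :: nat
proof -
  assume "j < m"
  then have "Suc j * N \<le> m * N" by (intro mult_le_mono1) simp
  then show ?thesis by auto
qed

text \<open>Block \<open>j\<close> contains only actual users, so the restrictions introduced by
  \<open>output_prob_discrete\<close> disappear.\<close>

lemma estimate_restrict: "j < m \<Longrightarrow> estimate \<epsilon> N j (restrict y {..<m * N}) = estimate \<epsilon> N j y"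
  using estimate_block_subset[of j m N] unfolding estimate_def by (intro sum.cong) auto

text \<open>The weight 4 / (\<epsilon> N) undoes the contraction \<epsilon>/4 of randomized
  response, so the estimate is unbiased. Its N terms are bounded by that weight, and Chebyshev gives
  N (8 / (\<epsilon> N))^2 / t^2.\<close>

lemma estimate_deviation:
  assumes \<epsilon>: "\<epsilon> \<in> {0<..1}" and "dist_on k p" "N > 0" "j < m" "t > 0"
  shows "measure_pmf.prob (Pi_pmf {..<m * N} d (\<lambda>i. message_law \<epsilon> (block k (i div N) u) p))
      {y. t \<le> \<bar>estimate \<epsilon> N j y - signed_sum (\<lambda>x. pmf p (Suc x)) k (block k j u)\<bar>}
    \<le> 64 / (\<epsilon>\<^sup>2 * real N * t\<^sup>2)"
proof -
  let ?c = "4 / (\<epsilon> * real N)" and ?J = "{j * N..<Suc j * N}"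
  let ?law = "\<lambda>i. message_law \<epsilon> (block k (i div N) u) p"
  let ?D = "signed_sum (\<lambda>x. pmf p (Suc x)) k (block k j u)"
  have div: "i div N = j" if "i \<in> ?J" for i
    using that by (intro div_nat_eqI) (auto simp: mult.commute)
  have "(\<Sum>i\<in>?J. measure_pmf.expectation (?law i) (\<lambda>y. ?c * y)) = (\<Sum>i\<in>?J. ?c * (\<epsilon> / 4 * ?D))"
    using assms by (intro sum.cong) (simp_all add: div expectation_message_law)
  also have "\<dots> = ?D" using \<epsilon> \<open>N > 0\<close> by simp
  finally have mean: "(\<Sum>i\<in>?J. measure_pmf.expectation (?law i) (\<lambda>y. ?c * y)) = ?D" .
  have restr: "estimate \<epsilon> N j (\<lambda>i. if i \<in> ?J then y i else d) = estimate \<epsilon> N j y" for y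
    unfolding estimate_def by (intro sum.cong) auto
  \<comment> \<open>The estimate sees only its own block, so the product law is replaced by its
    marginal there.\<close>
  have "Pi_pmf ?J d ?law = map_pmf (\<lambda>y i. if i \<in> ?J then y i else d) (Pi_pmf {..<m * N} d ?law)"
    using estimate_block_subset[OF \<open>j < m\<close>] by (intro Pi_pmf_subset) auto
  then have "measure_pmf.prob (Pi_pmf {..<m * N} d ?law) {y. t \<le> \<bar>estimate \<epsilon> N j y - ?D\<bar>}
      = measure_pmf.prob (Pi_pmf ?J d ?law) {y. t \<le> \<bar>estimate \<epsilon> N j y - ?D\<bar>}"
    by (simp only: measure_map_pmf vimage_Collect_eq restr)
  also have "\<dots> \<le> real (card ?J) * (2 * ?c)\<^sup>2 / t\<^sup>2"
    unfolding estimate_def mean[symmetric]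
  proof (rule prob_sum_deviation_Pi_pmf)
    fix i y assume "y \<in> set_pmf (?law i)"
    then have "\<bar>y\<bar> = 1"
      using set_randomized_response by (fastforce simp: message_law_def)
    then show "\<bar>?c * y\<bar> \<le> ?c" using \<epsilon> by (simp add: abs_mult)
  qed (use \<open>t > 0\<close> in auto)
  also have "\<dots> = 64 / (\<epsilon>\<^sup>2 * real N * t\<^sup>2)"
    using \<open>N > 0\<close> by (simp add: power_mult_distrib power_divide field_simps power2_eq_square)
  finally show ?thesis .
qed

subsection \<open>The tester\<close>

text \<open>The groups may have different block sizes, but block \<open>j\<close> of both uses the
  same sign vector, so the difference of the estimates targets the signed sum of p - q.\<close>

definition sign_tester :: "nat \<Rightarrow> real \<Rightarrow> real \<Rightarrow> real \<Rightarrow> nat \<Rightarrow> nat \<Rightarrow> nat \<Rightarrow> real protocol" where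
  "sign_tester k \<tau> \<epsilon>1 \<epsilon>2 N1 N2 m = \<lparr>
    num1 = m * N1, num2 = m * N2, coins = m * k, msg_space = count_space UNIV,
    rand1 = (\<lambda>i x u. measure_pmf (randomized_response \<epsilon>1 (block k (i div N1) u ! (x - 1)))),
    rand2 = (\<lambda>i x u. measure_pmf (randomized_response \<epsilon>2 (block k (i div N2) u ! (x - 1)))),
    analyzer = (\<lambda>y y' u. \<forall>j<m. \<bar>estimate \<epsilon>1 N1 j y - estimate \<epsilon>2 N2 j y'\<bar> < \<tau>)\<rparr>"

lemma sign_tester_simps:
  "num1 (sign_tester k \<tau> \<epsilon>1 \<epsilon>2 N1 N2 m) = m * N1"
  "num2 (sign_tester k \<tau> \<epsilon>1 \<epsilon>2 N1 N2 m) = m * N2"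
  "coins (sign_tester k \<tau> \<epsilon>1 \<epsilon>2 N1 N2 m) = m * k"
  "msg_space (sign_tester k \<tau> \<epsilon>1 \<epsilon>2 N1 N2 m) = count_space UNIV"
  "rand1 (sign_tester k \<tau> \<epsilon>1 \<epsilon>2 N1 N2 m)
    = (\<lambda>i x u. measure_pmf (randomized_response \<epsilon>1 (block k (i div N1) u ! (x - 1))))"
  "rand2 (sign_tester k \<tau> \<epsilon>1 \<epsilon>2 N1 N2 m)
    = (\<lambda>i x u. measure_pmf (randomized_response \<epsilon>2 (block k (i div N2) u ! (x - 1))))"
  "analyzer (sign_tester k \<tau> \<epsilon>1 \<epsilon>2 N1 N2 m)
    = (\<lambda>y y' u. \<forall>j<m. \<bar>estimate \<epsilon>1 N1 j y - estimate \<epsilon>2 N2 j y'\<bar> < \<tau>)"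
  by (simp_all add: sign_tester_def)

lemma measurable_estimate:
  assumes "j < m"
  shows "estimate \<epsilon> N j \<in> borel_measurable (PiM {..<m * N} (\<lambda>_. count_space UNIV))"
  unfolding estimate_def
proof (intro borel_measurable_sum)
  fix i assume "i \<in> {j * N..<Suc j * N}"
  with estimate_block_subset[OF assms, of N] have "i \<in> {..<m * N}" by blast
  then show "(\<lambda>y. 4 / (\<epsilon> * real N) * y i) \<in> borel_measurable (PiM {..<m * N} (\<lambda>_. count_space UNIV))"
    by (rule measurable_compose[OF measurable_component_singleton]) simp
qed

lemma sign_tester_analyzer_measurable:
  "(\<lambda>(y, y'). analyzer (sign_tester k \<tau> \<epsilon>1 \<epsilon>2 N1 N2 m) y y' u)
    \<in> PiM {..<m * N1} (\<lambda>_. count_space UNIV) \<Otimes>\<^sub>M PiM {..<m * N2} (\<lambda>_. count_space UNIV)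
      \<rightarrow>\<^sub>M count_space UNIV"
proof -
  let ?K = "PiM {..<m * N1} (\<lambda>_. count_space UNIV) \<Otimes>\<^sub>M PiM {..<m * N2} (\<lambda>_. count_space UNIV)"
  have "(\<lambda>z. \<bar>estimate \<epsilon>1 N1 j (fst z) - estimate \<epsilon>2 N2 j (snd z)\<bar> < \<tau>) \<in> ?K \<rightarrow>\<^sub>M count_space UNIV"
    if "j \<in> {..<m}" for j
  proof -
    have [measurable]: "(\<lambda>z. estimate \<epsilon>1 N1 j (fst z)) \<in> borel_measurable ?K"
      "(\<lambda>z. estimate \<epsilon>2 N2 j (snd z)) \<in> borel_measurable ?K"
      using that by (auto intro: measurable_compose[OF measurable_fst] measurable_compose[OF measurable_snd]
          measurable_estimate)
    show ?thesis by measurable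
  qed
  then have "(\<lambda>z. \<forall>j\<in>{..<m}. \<bar>estimate \<epsilon>1 N1 j (fst z) - estimate \<epsilon>2 N2 j (snd z)\<bar> < \<tau>)
      \<in> ?K \<rightarrow>\<^sub>M count_space UNIV"
    by (intro pred_intros_finite) auto
  also have "(\<lambda>z. \<forall>j\<in>{..<m}. \<bar>estimate \<epsilon>1 N1 j (fst z) - estimate \<epsilon>2 N2 j (snd z)\<bar> < \<tau>)
      = (\<lambda>(y, y'). analyzer (sign_tester k \<tau> \<epsilon>1 \<epsilon>2 N1 N2 m) y y' u)"
    by (auto simp: sign_tester_simps fun_eq_iff)
  finally show ?thesis .
qed

lemma measure_pmf_in_prob_algebra: "measure_pmf p \<in> space (prob_algebra (count_space UNIV))"
  by (simp add: space_prob_algebra measure_pmf.prob_space_axioms)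

lemma valid_sign_tester: "valid_protocol k (sign_tester k \<tau> \<epsilon>1 \<epsilon>2 N1 N2 m)"
  unfolding valid_protocol_def sign_tester_simps(1-6)
  by (intro conjI ballI allI impI measure_pmf_in_prob_algebra sign_tester_analyzer_measurable)

text \<open>Once the public string is fixed, the sample only selects the bit given to randomized
  response, which is private for any two bits.\<close>

lemma ldp_sign_tester:
  assumes "\<epsilon>1 \<in> {0<..1}" "\<epsilon>2 \<in> {0<..1}"
  shows "ldp_group1 k \<epsilon>1 0 (sign_tester k \<tau> \<epsilon>1 \<epsilon>2 N1 N2 m)"
    and "ldp_group2 k \<epsilon>2 0 (sign_tester k \<tau> \<epsilon>1 \<epsilon>2 N1 N2 m)"
  unfolding ldp_group1_def ldp_group2_def ldp_randomizer_def sign_tester_simps add_0_right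
  using assms by (blast intro: randomized_response_private)+

section \<open>Error analysis of the tester\<close>

definition message_laws ::
  "nat \<Rightarrow> real \<Rightarrow> nat \<Rightarrow> nat \<Rightarrow> bool list \<Rightarrow> nat pmf \<Rightarrow> (nat \<Rightarrow> real) pmf" where
  "message_laws k \<epsilon> N m u p
    = Pi_pmf {..<m * N} 0 (\<lambda>i. message_law \<epsilon> (block k (i div N) u) p)"

lemma output_prob_sign_tester:
  "output_prob (sign_tester k \<tau> \<epsilon>1 \<epsilon>2 N1 N2 m) p q b
    = measure_pmf.expectation (pmf_of_set (bit_strings (m * k))) (\<lambda>u. measure_pmf.prob
        (pair_pmf (message_laws k \<epsilon>1 N1 m u p) (message_laws k \<epsilon>2 N2 m u q))
        {(y, y'). (\<forall>j<m. \<bar>estimate \<epsilon>1 N1 j y - estimate \<epsilon>2 N2 j y'\<bar> < \<tau>) = b})"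
proof -
  let ?P = "sign_tester k \<tau> \<epsilon>1 \<epsilon>2 N1 N2 m"
  have "analyzer ?P (restrict y {..<m * N1}) (restrict y' {..<m * N2}) u
      \<longleftrightarrow> (\<forall>j<m. \<bar>estimate \<epsilon>1 N1 j y - estimate \<epsilon>2 N2 j y'\<bar> < \<tau>)" for y y' u
    by (simp add: sign_tester_simps estimate_restrict)
  moreover note output_prob_discrete[of ?P _ _ p q b 0, unfolded sign_tester_simps(1-3,5,6),
      OF sign_tester_analyzer_measurable refl refl]
  ultimately show ?thesis
    by (simp add: message_laws_def message_law_def)
qed

text \<open>An error of \<tau> in the difference forces an error of \<tau>/2 in one of the
  estimates; halving the threshold turns 64 into 256.\<close>

lemma estimate_difference_deviation:
  fixes k N1 N2 m :: nat and u p q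
  assumes \<epsilon>: "\<epsilon>1 \<in> {0<..1}" "\<epsilon>2 \<in> {0<..1}" and "dist_on k p" "dist_on k q"
    and "N1 > 0" "N2 > 0" "j < m" "\<tau> > 0"
  shows "measure_pmf.prob (pair_pmf (message_laws k \<epsilon>1 N1 m u p) (message_laws k \<epsilon>2 N2 m u q))
      {(y, y'). \<tau> \<le> \<bar>estimate \<epsilon>1 N1 j y - estimate \<epsilon>2 N2 j y'
        - signed_sum (\<lambda>x. pmf p (Suc x) - pmf q (Suc x)) k (block k j u)\<bar>}
    \<le> 256 / (\<epsilon>1\<^sup>2 * real N1 * \<tau>\<^sup>2) + 256 / (\<epsilon>2\<^sup>2 * real N2 * \<tau>\<^sup>2)"
proof -
  let ?W = "pair_pmf (message_laws k \<epsilon>1 N1 m u p) (message_laws k \<epsilon>2 N2 m u q)"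
  define D where "D p = signed_sum (\<lambda>x. pmf p (Suc x)) k (block k j u)" for p
  define E where "E \<epsilon> N p = {y. \<tau> / 2 \<le> \<bar>estimate \<epsilon> N j y - D p\<bar>}" for \<epsilon> N p
  have D_diff: "signed_sum (\<lambda>x. pmf p (Suc x) - pmf q (Suc x)) k (block k j u) = D p - D q"
    by (simp add: D_def signed_sum_def left_diff_distrib sum_subtractf)
  have "measure_pmf.prob ?W {(y, y'). \<tau> \<le> \<bar>estimate \<epsilon>1 N1 j y - estimate \<epsilon>2 N2 j y' - (D p - D q)\<bar>}
      \<le> measure_pmf.prob ?W (fst -` E \<epsilon>1 N1 p \<union> snd -` E \<epsilon>2 N2 q)"
  proof (intro measure_pmf.finite_measure_mono subsetI)
    fix z assume "z \<in> {(y, y'). \<tau> \<le> \<bar>estimate \<epsilon>1 N1 j y - estimate \<epsilon>2 N2 j y' - (D p - D q)\<bar>}"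
    then have "\<tau> \<le> \<bar>estimate \<epsilon>1 N1 j (fst z) - D p\<bar> + \<bar>estimate \<epsilon>2 N2 j (snd z) - D q\<bar>"
      by (auto simp: case_prod_unfold)
    then show "z \<in> fst -` E \<epsilon>1 N1 p \<union> snd -` E \<epsilon>2 N2 q"
      by (auto simp: E_def)
  qed simp
  also have "\<dots> \<le> measure_pmf.prob ?W (fst -` E \<epsilon>1 N1 p) + measure_pmf.prob ?W (snd -` E \<epsilon>2 N2 q)"
    by (intro measure_Un_le) auto
  also have "\<dots> = measure_pmf.prob (message_laws k \<epsilon>1 N1 m u p) (E \<epsilon>1 N1 p)
      + measure_pmf.prob (message_laws k \<epsilon>2 N2 m u q) (E \<epsilon>2 N2 q)"
    by (simp only: measure_map_pmf[symmetric] map_fst_pair_pmf map_snd_pair_pmf)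
  also have "\<dots> \<le> 64 / (\<epsilon>1\<^sup>2 * real N1 * (\<tau> / 2)\<^sup>2) + 64 / (\<epsilon>2\<^sup>2 * real N2 * (\<tau> / 2)\<^sup>2)"
    unfolding E_def D_def message_laws_def
    using assms by (intro add_mono estimate_deviation) auto
  also have "\<dots> = 256 / (\<epsilon>1\<^sup>2 * real N1 * \<tau>\<^sup>2) + 256 / (\<epsilon>2\<^sup>2 * real N2 * \<tau>\<^sup>2)"
    by (simp add: power_divide)
  finally show ?thesis unfolding D_diff .
qed

text \<open>Cauchy-Schwarz, since twice the total variation distance is the l1 norm.\<close>

lemma tv_dist_le_square_sum:
  "4 * (tv_dist k p q)\<^sup>2 \<le> real k * (\<Sum>x<k. (pmf p (Suc x) - pmf q (Suc x))\<^sup>2)"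
proof -
  have "2 * tv_dist k p q = (\<Sum>x<k. \<bar>pmf p (Suc x) - pmf q (Suc x)\<bar>)"
    unfolding tv_dist_def image_Suc_lessThan[symmetric] by (simp add: sum.reindex)
  then have "4 * (tv_dist k p q)\<^sup>2 = (\<Sum>x<k. \<bar>pmf p (Suc x) - pmf q (Suc x)\<bar>)\<^sup>2"
    by (simp add: power_mult_distrib flip: \<open>2 * tv_dist k p q = _\<close>)
  also have "\<dots> \<le> (\<Sum>x<k. \<bar>pmf p (Suc x) - pmf q (Suc x)\<bar>\<^sup>2) * real (card {..<k})"
    by (rule sum_squared_le_sum_of_squares)
  finally show ?thesis by (simp add: mult.commute)
qed

lemma closeness_tester_sign_tester:
  assumes k: "k \<ge> 1" and \<alpha>: "\<alpha> > 0" and \<epsilon>: "\<epsilon>1 \<in> {0<..1}" "\<epsilon>2 \<in> {0<..1}"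
    and N: "real N1 \<ge> 49152 * (real k / (\<alpha>\<^sup>2 * \<epsilon>1\<^sup>2))" "real N2 \<ge> 49152 * (real k / (\<alpha>\<^sup>2 * \<epsilon>2\<^sup>2))"
  shows "closeness_tester k \<alpha> (sign_tester k (\<alpha> / (2 * sqrt (real k))) \<epsilon>1 \<epsilon>2 N1 N2 8)"
proof -
  define \<tau> where "\<tau> = \<alpha> / (2 * sqrt (real k))"
  have \<tau>: "\<tau> > 0" "\<tau>\<^sup>2 = \<alpha>\<^sup>2 / (4 * real k)"
    using k \<alpha> by (simp_all add: \<tau>_def power_divide power_mult_distrib)
  have small: "N > 0" "256 / (\<epsilon>\<^sup>2 * real N * \<tau>\<^sup>2) \<le> 1 / 48"
    if "\<epsilon> \<in> {0<..1}" "real N \<ge> 49152 * (real k / (\<alpha>\<^sup>2 * \<epsilon>\<^sup>2))" for \<epsilon> N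
  proof -
    have pos: "real k / (\<alpha>\<^sup>2 * \<epsilon>\<^sup>2) > 0" using k \<alpha> that(1) by simp
    with that(2) have "real N > 0" by linarith
    then show "N > 0" by simp
    \<comment> \<open>Here 1024 = 256 * 4 comes from the value of \<open>\<tau>\<^sup>2\<close>, and
      49152 = 1024 * 48. The two groups together then err with probability at most 2/48 = 1/24 per
      block.\<close>
    have "256 / (\<epsilon>\<^sup>2 * real N * \<tau>\<^sup>2) = 1024 * (real k / (\<alpha>\<^sup>2 * \<epsilon>\<^sup>2)) / real N"
      by (simp add: \<tau>(2) mult_ac)
    also have "\<dots> \<le> 1 / 48"
      unfolding pos_divide_le_eq[OF \<open>real N > 0\<close>] using that(2) by linarith
    finally show "256 / (\<epsilon>\<^sup>2 * real N * \<tau>\<^sup>2) \<le> 1 / 48" .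
  qed
  let ?U = "pmf_of_set (bit_strings (8 * k))"
  let ?W = "\<lambda>p q u. pair_pmf (message_laws k \<epsilon>1 N1 8 u p) (message_laws k \<epsilon>2 N2 8 u q)"
  let ?Z = "\<lambda>j y y'. estimate \<epsilon>1 N1 j y - estimate \<epsilon>2 N2 j y'"
  let ?S = "\<lambda>p q j u. signed_sum (\<lambda>x. pmf p (Suc x) - pmf q (Suc x)) k (block k j u)"
  have deviation: "measure_pmf.prob (?W p q u) {(y, y'). \<tau> \<le> \<bar>?Z j y y' - ?S p q j u\<bar>} \<le> 1 / 24"
    if "dist_on k p" "dist_on k q" "j < 8" for p q j u
  proof -
    have "measure_pmf.prob (?W p q u) {(y, y'). \<tau> \<le> \<bar>?Z j y y' - ?S p q j u\<bar>}
        \<le> 256 / (\<epsilon>1\<^sup>2 * real N1 * \<tau>\<^sup>2) + 256 / (\<epsilon>2\<^sup>2 * real N2 * \<tau>\<^sup>2)"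
      using that \<epsilon> \<tau>(1) small(1)[OF \<epsilon>(1) N(1)] small(1)[OF \<epsilon>(2) N(2)]
      by (intro estimate_difference_deviation) auto
    with small(2)[OF \<epsilon>(1) N(1)] small(2)[OF \<epsilon>(2) N(2)] show ?thesis by linarith
  qed
  have integrable: "integrable ?U f" for f :: "bool list \<Rightarrow> real"
    by (intro integrable_measure_pmf_finite) (simp add: finite_bit_strings bit_strings_nonempty)
  have complete: "2 / 3 \<le> output_prob (sign_tester k \<tau> \<epsilon>1 \<epsilon>2 N1 N2 8) p p True"
    if p: "dist_on k p" for p
  proof -
    \<comment> \<open>For equal distributions every signed sum vanishes, so rejection requires a
      deviation in some block. The union bound 8/24 = 1/3 holds for each public string
      separately.\<close>
    have "2 / 3 \<le> measure_pmf.prob (?W p p u) {(y, y'). (\<forall>j<8. \<bar>?Z j y y'\<bar> < \<tau>) = True}" for u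
    proof -
      let ?A = "{(y, y'). (\<forall>j<8. \<bar>?Z j y y'\<bar> < \<tau>) = True}"
      have "measure_pmf.prob (?W p p u) (- ?A)
          = measure_pmf.prob (?W p p u) (\<Union>j\<in>{..<8}. {(y, y'). \<tau> \<le> \<bar>?Z j y y' - ?S p p j u\<bar>})"
        by (rule arg_cong[where f = "measure_pmf.prob _"]) (auto simp: signed_sum_def not_less)
      also have "\<dots> \<le> (\<Sum>j\<in>{..<8}. measure_pmf.prob (?W p p u) {(y, y'). \<tau> \<le> \<bar>?Z j y y' - ?S p p j u\<bar>})"
        by (intro measure_UNION_le) auto
      also have "\<dots> \<le> (\<Sum>j\<in>{..<8::nat}. 1 / 24)"
        using deviation[OF p p] by (intro sum_mono) auto
      finally show ?thesis
        using measure_pmf.prob_compl[of ?A "?W p p u"] by (simp add: Compl_eq_Diff_UNIV)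
    qed
    then show ?thesis
      unfolding output_prob_sign_tester
      by (intro measure_pmf.integral_ge_const integrable) auto
  qed
  have sound: "2 / 3 \<le> output_prob (sign_tester k \<tau> \<epsilon>1 \<epsilon>2 N1 N2 8) p q False"
    if p: "dist_on k p" and q: "dist_on k q" and far: "tv_dist k p q > \<alpha>" for p q
  proof -
    define V where "V = (\<Sum>x<k. (pmf p (Suc x) - pmf q (Suc x))\<^sup>2)"
    have "4 * \<alpha>\<^sup>2 \<le> 4 * (tv_dist k p q)\<^sup>2" using far \<alpha> by (intro mult_left_mono power_mono) auto
    also have "\<dots> \<le> real k * V" unfolding V_def by (rule tv_dist_le_square_sum)
    \<comment> \<open>V is at least 4 \<alpha>^2 / k, so V/4 is at least \<alpha>^2 / k, which is
      exactly (2 \<tau>)^2.\<close>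
    finally have V: "(2 * \<tau>)\<^sup>2 \<le> V / 4" "V > 0"
      using k \<alpha> zero_less_mult_pos[of "real k" V] less_le_trans[of 0 "4 * \<alpha>\<^sup>2" "real k * V"]
      by (simp_all add: power_mult_distrib \<tau>(2) field_simps)
    \<comment> \<open>The good strings: some block separates the two means by at least 2
      \<tau>.\<close>
    define G where "G = {u. \<exists>j<8. V / 4 \<le> (?S p q j u)\<^sup>2}"
    have "measure_pmf.prob ?U (- G) \<le> (13 / 16) ^ 8"
      using prob_all_blocks_small[OF V_def V(2), of 8] by (simp add: G_def Collect_neg_eq[symmetric] not_le)
    then have G: "1 - (13 / 16) ^ 8 \<le> measure_pmf.prob ?U G"
      using measure_pmf.prob_compl[of G ?U] by (simp add: Compl_eq_Diff_UNIV)
    have reject: "23 / 24 * indicator G u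
        \<le> measure_pmf.prob (?W p q u) {(y, y'). (\<forall>j<8. \<bar>?Z j y y'\<bar> < \<tau>) = False}" for u
    proof (cases "u \<in> G")
      case True
      let ?A = "{(y, y'). (\<forall>j<8. \<bar>?Z j y y'\<bar> < \<tau>) = False}"
      from True obtain j where j: "j < 8" "V / 4 \<le> (?S p q j u)\<^sup>2" by (auto simp: G_def)
      with V(1) have "(2 * \<tau>)\<^sup>2 \<le> (?S p q j u)\<^sup>2" by linarith
      then have "\<bar>2 * \<tau>\<bar> \<le> \<bar>?S p q j u\<bar>" by (simp only: abs_le_square_iff)
      then have "2 * \<tau> \<le> \<bar>?S p q j u\<bar>" by simp
      \<comment> \<open>Acceptance puts the estimated difference below \<tau> while its target is at
        least 2 \<tau> in absolute value, so the estimation error exceeds \<tau>.\<close>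
      then have "- ?A \<subseteq> {(y, y'). \<tau> \<le> \<bar>?Z j y y' - ?S p q j u\<bar>}"
        using j(1) by fastforce
      then have "measure_pmf.prob (?W p q u) (- ?A)
          \<le> measure_pmf.prob (?W p q u) {(y, y'). \<tau> \<le> \<bar>?Z j y y' - ?S p q j u\<bar>}"
        by (rule measure_pmf.finite_measure_mono) simp
      also have "\<dots> \<le> 1 / 24" by (rule deviation[OF p q j(1)])
      finally have "measure_pmf.prob (?W p q u) (- ?A) \<le> 1 / 24" .
      with True show ?thesis
        using measure_pmf.prob_compl[of ?A "?W p q u"] by (simp add: Compl_eq_Diff_UNIV)
    qed simp
    \<comment> \<open>Eight blocks are enough here: (13/16)^8 is about 0.19, so the product is about
      0.78.\<close>
    have "2 / 3 \<le> 23 / 24 * (1 - (13 / 16) ^ 8 :: real)" by (simp add: power_divide)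
    also have "\<dots> \<le> 23 / 24 * measure_pmf.prob ?U G" using G by (intro mult_left_mono) auto
    also have "\<dots> = measure_pmf.expectation ?U (\<lambda>u. 23 / 24 * indicator G u)" by simp
    also have "\<dots> \<le> output_prob (sign_tester k \<tau> \<epsilon>1 \<epsilon>2 N1 N2 8) p q False"
      unfolding output_prob_sign_tester by (intro integral_mono integrable reject)
    finally show ?thesis .
  qed
  show ?thesis
    using complete sound by (auto simp: closeness_tester_def simp flip: \<tau>_def)
qed

theorem theorem3p6:
  "\<exists>C::real. C > 0 \<and>
    (\<forall>(k::nat) (\<alpha>::real) (\<epsilon>1::real) (\<epsilon>2::real).
       k \<ge> 1 \<longrightarrow> \<alpha> \<in> {0<..1} \<longrightarrow> \<epsilon>1 \<in> {0<..1} \<longrightarrow> \<epsilon>2 \<in> {0<..1} \<longrightarrow>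
       (\<exists>P :: real protocol.
          valid_protocol k P \<and> public_coin P \<and>
          real (num1 P) \<le> C * (real k / (\<alpha>\<^sup>2 * \<epsilon>1\<^sup>2)) \<and>
          real (num2 P) \<le> C * (real k / (\<alpha>\<^sup>2 * \<epsilon>2\<^sup>2)) \<and>
          ldp_group1 k \<epsilon>1 0 P \<and> ldp_group2 k \<epsilon>2 0 P \<and>
          closeness_tester k \<alpha> P))"
proof (intro exI[where x = "8 * 49153"] conjI allI impI)
  fix k :: nat and \<alpha> \<epsilon>1 \<epsilon>2 :: real
  assume k: "k \<ge> 1" and \<alpha>: "\<alpha> \<in> {0<..1}" and \<epsilon>: "\<epsilon>1 \<in> {0<..1}" "\<epsilon>2 \<in> {0<..1}"
  define N where "N \<epsilon> = nat \<lceil>49152 * (real k / (\<alpha>\<^sup>2 * \<epsilon>\<^sup>2))\<rceil>" for \<epsilon>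
  have N: "49152 * (real k / (\<alpha>\<^sup>2 * \<epsilon>\<^sup>2)) \<le> real (N \<epsilon>)"
    "real (8 * N \<epsilon>) \<le> 8 * 49153 * (real k / (\<alpha>\<^sup>2 * \<epsilon>\<^sup>2))" if "\<epsilon> \<in> {0<..1}" for \<epsilon>
  proof -
    \<comment> \<open>Since k / (\<alpha>^2 \<epsilon>^2) is at least 1, it absorbs the rounding:
      the ceiling costs at most one more multiple, 49153 in place of 49152, and the factor 8 counts
      the blocks.\<close>
    have "\<alpha>\<^sup>2 * \<epsilon>\<^sup>2 \<le> 1" using \<alpha> that by (intro mult_le_one power_le_one) auto
    with k have "\<alpha>\<^sup>2 * \<epsilon>\<^sup>2 \<le> real k" by linarith
    with \<alpha> that have "1 \<le> real k / (\<alpha>\<^sup>2 * \<epsilon>\<^sup>2)" by (simp add: le_divide_eq)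
    then show "49152 * (real k / (\<alpha>\<^sup>2 * \<epsilon>\<^sup>2)) \<le> real (N \<epsilon>)"
      "real (8 * N \<epsilon>) \<le> 8 * 49153 * (real k / (\<alpha>\<^sup>2 * \<epsilon>\<^sup>2))"
      unfolding N_def by linarith+
  qed
  let ?P = "sign_tester k (\<alpha> / (2 * sqrt (real k))) \<epsilon>1 \<epsilon>2 (N \<epsilon>1) (N \<epsilon>2) 8"
  show "\<exists>P :: real protocol.
      valid_protocol k P \<and> public_coin P \<and>
      real (num1 P) \<le> 8 * 49153 * (real k / (\<alpha>\<^sup>2 * \<epsilon>1\<^sup>2)) \<and>
      real (num2 P) \<le> 8 * 49153 * (real k / (\<alpha>\<^sup>2 * \<epsilon>2\<^sup>2)) \<and>
      ldp_group1 k \<epsilon>1 0 P \<and> ldp_group2 k \<epsilon>2 0 P \<and>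
      closeness_tester k \<alpha> P"
  proof (intro exI[where x = ?P] conjI)
    show "public_coin ?P" using k by (simp add: public_coin_def sign_tester_simps)
    show "real (num1 ?P) \<le> 8 * 49153 * (real k / (\<alpha>\<^sup>2 * \<epsilon>1\<^sup>2))"
      "real (num2 ?P) \<le> 8 * 49153 * (real k / (\<alpha>\<^sup>2 * \<epsilon>2\<^sup>2))"
      using N(2)[OF \<epsilon>(1)] N(2)[OF \<epsilon>(2)] by (simp_all add: sign_tester_simps)
    show "closeness_tester k \<alpha> ?P"
      using k \<alpha> \<epsilon> N(1)[OF \<epsilon>(1)] N(1)[OF \<epsilon>(2)] by (intro closeness_tester_sign_tester) auto
  qed (use \<epsilon> in \<open>simp_all add: valid_sign_tester ldp_sign_tester\<close>)
qed simp

end
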